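(* For every dynamic uncompressed quadtree $T_1$ over $\mathbb{R}^d$, subject to split and merge operations, one can maintain its extended quadtree $T^*$ (with $T_1\subseteq T^*$) using at most $\mathcal{O}((2d)^d)$ operations per split or merge on $T_1$.
   Context: A quadtree on an axis-aligned root hypercube $R\subset\mathbb{R}^d$ is a hierarchical decomposition in which every node has an associated axis-aligned hypercube (cell) and is either a leaf or has $2^d$ equal-sized children whose cells subdivide its cell. The size $|C|$ of a cell is its edge length. The split operation on a leaf $C$ inserts the $2^d$ equal-sized children of $C$; the merge operation on $2^d$ leaves with a common parent removes these $2^d$ cells. Two cells are neighbors if they are interior-disjoint and share (part of) a $(d-1)$-dimensional facet. For an integer $j$, a cell $C$ is $2^j$-smooth if every leaf neighboring $C$ has size at most $2^j|C|$. Extended quadtree: the cells of $T_1$ get brand $1$. Recursively, for $j\ge1$, let $T^j$ be the quadtree formed by $\bigcup_{i\le j}T_i$, and let $T_{j+1}$ be the minimal set of cells obtained by splitting cells of $T^j$ such that every cell of $T_j$ is $2^j$-smooth in the resulting quadtree; the cells of $T_{j+1}$ get brand $j+1$. The extended quadtree is $T^*=T^{d+1}$. Operations counted are split/merge operations (and brand updates) performed on $T^*$. *)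

theory Defs
  imports Complex_Main
begin

text \<open>Dyadic cells of the root hypercube, normalised (by scaling/translation, which does
not affect the combinatorics) to the unit cube [0,1]^d.  A cell (k, x) with
length x = d and x!i < 2^k is the box prod_i [x!i / 2^k, (x!i+1) / 2^k].\<close>

type_synonym cell = "nat \<times> nat list"

definition valid_cell :: "nat \<Rightarrow> cell \<Rightarrow> bool" where
  "valid_cell d c \<longleftrightarrow> length (snd c) = d \<and> (\<forall>i\<in>set (snd c). i < 2 ^ fst c)"

definition root_cell :: "nat \<Rightarrow> cell" where
  "root_cell d = (0, replicate d 0)"

definition children :: "nat \<Rightarrow> cell \<Rightarrow> cell set" where
  "children d c = {(Suc (fst c), y) | y. length y = d \<and> (\<forall>i<d. y ! i div 2 = snd c ! i)}"

definition parent :: "cell \<Rightarrow> cell" where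
  "parent c = (fst c - 1, map (\<lambda>i. i div 2) (snd c))"

definition cell_size :: "cell \<Rightarrow> real" where
  "cell_size c = (1/2) ^ fst c"

definition lo :: "cell \<Rightarrow> nat \<Rightarrow> real" where
  "lo c i = real (snd c ! i) / 2 ^ fst c"

definition hi :: "cell \<Rightarrow> nat \<Rightarrow> real" where
  "hi c i = (real (snd c ! i) + 1) / 2 ^ fst c"

definition quadtree :: "nat \<Rightarrow> cell set \<Rightarrow> bool" where
  "quadtree d T \<longleftrightarrow> finite T \<and> root_cell d \<in> T \<and> (\<forall>c\<in>T. valid_cell d c)
     \<and> (\<forall>c\<in>T. fst c > 0 \<longrightarrow> parent c \<in> T)
     \<and> (\<forall>c\<in>T. children d c \<inter> T \<noteq> {} \<longrightarrow> children d c \<subseteq> T)"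

definition leaf :: "nat \<Rightarrow> cell set \<Rightarrow> cell \<Rightarrow> bool" where
  "leaf d T c \<longleftrightarrow> c \<in> T \<and> children d c \<inter> T = {}"

text \<open>Neighbors: interior-disjoint boxes sharing a (d-1)-dimensional part of a facet,
i.e. they touch in exactly one coordinate direction j and their open extents overlap
in every other coordinate.\<close>
definition neighbors :: "nat \<Rightarrow> cell \<Rightarrow> cell \<Rightarrow> bool" where
  "neighbors d c c' \<longleftrightarrow> (\<exists>j<d. (hi c j = lo c' j \<or> hi c' j = lo c j)
      \<and> (\<forall>i<d. i \<noteq> j \<longrightarrow> lo c i < hi c' i \<and> lo c' i < hi c i))"

definition smooth :: "nat \<Rightarrow> cell set \<Rightarrow> nat \<Rightarrow> cell \<Rightarrow> bool" where
  "smooth d T j c \<longleftrightarrow> (\<forall>n. leaf d T n \<and> neighbors d c n \<longrightarrow> cell_size n \<le> 2 ^ j * cell_size c)"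

text \<open>ext d T j = T^j (union of brands 1..j); T^0 = {}, T^1 = T_1,
T^{j+1} = the minimal refinement of T^j in which all cells of T_j = T^j - T^{j-1}
are 2^j-smooth.\<close>
fun ext :: "nat \<Rightarrow> cell set \<Rightarrow> nat \<Rightarrow> cell set" where
  "ext d T 0 = {}"
| "ext d T (Suc 0) = T"
| "ext d T (Suc (Suc j)) =
     \<Inter> {Q. quadtree d Q \<and> ext d T (Suc j) \<subseteq> Q
            \<and> (\<forall>c \<in> ext d T (Suc j) - ext d T j. smooth d Q (Suc j) c)}"

definition ext_tree :: "nat \<Rightarrow> cell set \<Rightarrow> cell set" where
  "ext_tree d T = ext d T (d + 1)"

definition brand :: "nat \<Rightarrow> cell set \<Rightarrow> cell \<Rightarrow> nat" where
  "brand d T c = (LEAST j. c \<in> ext d T j)"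

definition split_op :: "nat \<Rightarrow> cell set \<Rightarrow> cell set \<Rightarrow> bool" where
  "split_op d T T' \<longleftrightarrow> (\<exists>c. leaf d T c \<and> T' = T \<union> children d c)"

definition merge_op :: "nat \<Rightarrow> cell set \<Rightarrow> cell set \<Rightarrow> bool" where
  "merge_op d T T' \<longleftrightarrow> (\<exists>c\<in>T. children d c \<subseteq> T \<and> (\<forall>c'\<in>children d c. leaf d T c')
                         \<and> T' = T - children d c)"

definition op_step :: "nat \<Rightarrow> (cell set \<times> (cell \<Rightarrow> nat)) \<Rightarrow> (cell set \<times> (cell \<Rightarrow> nat)) \<Rightarrow> bool" where
  "op_step d s s' \<longleftrightarrow>
     (split_op d (fst s) (fst s') \<and> (\<forall>c\<in>fst s. snd s' c = snd s c))
   \<or> (merge_op d (fst s) (fst s') \<and> (\<forall>c\<in>fst s'. snd s' c = snd s c))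
   \<or> (\<exists>c0. fst s' = fst s \<and> (\<forall>c\<in>fst s. c \<noteq> c0 \<longrightarrow> snd s' c = snd s c))"

end

theory Submission
  imports Defs
begin

text \<open>
  A quadtree is determined by its set I of internal nodes. On this level the extension is explicit:
  I(1) = I, and I(j+1) adds to I(j) the j-fold parents of all equal-sized neighbours of nodes in
  I(j); no further closure is needed, because the parents of two neighbouring cells coincide or are
  neighbours. Each step thus distributes over unions, and a split at c only adds one node c to I.

  A node that is new in I(j) has its parent in the old I(j). Hence neighbours sharing the parent
  contribute nothing new, and since every cell has at most one neighbour per axis outside its
  parent, the number of new nodes grows at most by the factor d + 1 per brand. In total at most
  (d + 1)^d nodes are affected, each costing one split or at most 2^d brand updates, and
  (d + 1)^d 2^d is at most e (2d)^d. New nodes are leaves of the old extended tree, so the splits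
  can be made in any order; a merge is the same process reversed.
\<close>

declare split_paired_All [simp del] split_paired_Ex [simp del]

subsection \<open>Quadtrees as sets of internal nodes\<close>

text \<open>The empty set is allowed and encodes the tree whose only cell is the root. A nonempty
  closed set contains the root.\<close>

definition node_closed :: "nat \<Rightarrow> cell set \<Rightarrow> bool" where
  "node_closed d I \<longleftrightarrow> finite I \<and> (\<forall>c\<in>I. valid_cell d c \<and> parent c \<in> I)"

text \<open>The root is added separately: for \<open>I = {}\<close> the comprehension is empty, yet
  the root remains as a leaf.\<close>

definition tree_of :: "nat \<Rightarrow> cell set \<Rightarrow> cell set" where
  "tree_of d I = insert (root_cell d) {c. valid_cell d c \<and> parent c \<in> I}"

text \<open>The equal-size case of \<open>neighbors\<close> in integer coordinates, where taking
  parents becomes halving and no real arithmetic is needed.\<close>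

definition adjacent :: "nat \<Rightarrow> cell \<Rightarrow> cell \<Rightarrow> bool" where
  "adjacent d c c' \<longleftrightarrow> valid_cell d c \<and> valid_cell d c' \<and> fst c = fst c' \<and>
     (\<exists>i<d. (snd c' ! i = Suc (snd c ! i) \<or> snd c ! i = Suc (snd c' ! i)) \<and>
            (\<forall>k<d. k \<noteq> i \<longrightarrow> snd c' ! k = snd c ! k))"

text \<open>The root is its own parent, so iterating \<^const>\<open>parent\<close> beyond the level of a cell is harmless.\<close>

fun ext_nodes :: "nat \<Rightarrow> nat \<Rightarrow> cell set \<Rightarrow> cell set" where
  "ext_nodes d 0 I = I"
| "ext_nodes d (Suc j) I = ext_nodes d j I \<union>
     {(parent ^^ Suc j) P' | P P'. P \<in> ext_nodes d j I \<and> adjacent d P P'}"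

section \<open>Cells, parents and children\<close>

lemma parent_root [simp]: "parent (root_cell d) = root_cell d"
  by (simp add: parent_def root_cell_def)

lemma valid_root [simp]: "valid_cell d (root_cell d)"
  by (simp add: valid_cell_def root_cell_def)

lemma fst_root [simp]: "fst (root_cell d) = 0"
  by (simp add: root_cell_def)

lemma fst_parent [simp]: "fst (parent c) = fst c - 1"
  by (simp add: parent_def)

lemma length_parent [simp]: "length (snd (parent c)) = length (snd c)"
  by (simp add: parent_def)

lemma nth_parent: "i < length (snd c) \<Longrightarrow> snd (parent c) ! i = snd c ! i div 2"
  by (simp add: parent_def)

lemma valid_cell_iff:
  "valid_cell d c \<longleftrightarrow> length (snd c) = d \<and> (\<forall>i<d. snd c ! i < 2 ^ fst c)"
  by (auto simp: valid_cell_def all_set_conv_all_nth)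

lemma cell_eqI:
  assumes "valid_cell d c" "valid_cell d c'" "fst c = fst c'"
    and "\<And>i. i < d \<Longrightarrow> snd c ! i = snd c' ! i"
  shows "c = c'"
  using assms by (auto simp: valid_cell_iff prod_eq_iff intro: nth_equalityI)

lemma valid_level_0: "valid_cell d c \<Longrightarrow> fst c = 0 \<Longrightarrow> c = root_cell d"
  by (rule cell_eqI[of d]) (auto simp: valid_cell_iff root_cell_def)

lemma valid_parent: "valid_cell d c \<Longrightarrow> valid_cell d (parent c)"
  using valid_level_0[of d c]
  by (cases "fst c")
     (auto, auto simp: valid_cell_iff nth_parent less_mult_imp_div_less mult.commute)

text \<open>Remains true for \<open>t\<close> beyond the level of \<open>c\<close>, since truncated
  subtraction then stays at level 0.\<close>

lemma parent_pow_eq: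
  "(parent ^^ t) c = (fst c - t, map (\<lambda>i. i div 2 ^ t) (snd c))"
  by (induction t) (auto simp: parent_def div_mult2_eq[symmetric] mult.commute)

lemma valid_parent_pow: "valid_cell d c \<Longrightarrow> valid_cell d ((parent ^^ t) c)"
  by (induction t) (auto simp: valid_parent)

text \<open>The condition \<open>fst c > 0\<close> rules out the root, which is its own parent but
  not its own child.\<close>

lemma children_iff:
  assumes "valid_cell d P"
  shows "c \<in> children d P \<longleftrightarrow> valid_cell d c \<and> fst c > 0 \<and> parent c = P"
proof
  assume c: "c \<in> children d P"
  then have *: "fst c = Suc (fst P)" "length (snd c) = d" "\<forall>i<d. snd c ! i div 2 = snd P ! i"
    by (auto simp: children_def)
  have v: "valid_cell d c"
    unfolding valid_cell_iff
  proof (intro conjI allI impI)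
    fix i assume "i < d"
    then have "snd c ! i div 2 < 2 ^ fst P"
      using * assms by (auto simp: valid_cell_iff)
    then show "snd c ! i < 2 ^ fst c"
      using * by simp
  qed (use * in simp)
  moreover have "parent c = P"
    by (rule cell_eqI[of d]) (use * v assms in \<open>auto simp: valid_parent nth_parent\<close>)
  ultimately show "valid_cell d c \<and> fst c > 0 \<and> parent c = P"
    using * by simp
next
  assume "valid_cell d c \<and> fst c > 0 \<and> parent c = P"
  then show "c \<in> children d P"
    by (auto simp: children_def valid_cell_iff nth_parent intro!: exI[of _ "snd c"] prod_eqI)
qed

lemma children_ne: "children d P \<noteq> {}"
proof -
  have "(Suc (fst P), map (\<lambda>i. 2 * snd P ! i) [0..<d]) \<in> children d P"
    by (auto simp: children_def)
  then show ?thesis by blast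
qed

text \<open>A child is determined by the parities of its coordinates, since \<open>P\<close> fixes
  their halves.\<close>

lemma finite_children_card_le: "finite (children d P) \<and> card (children d P) \<le> 2 ^ d"
proof -
  let ?f = "\<lambda>c. map (\<lambda>v. v mod 2) (snd c) :: nat list"
  let ?L = "{xs :: nat list. set xs \<subseteq> {0,1} \<and> length xs = d}"
  have inj: "inj_on ?f (children d P)"
  proof (rule inj_onI)
    fix a b assume a: "a \<in> children d P" and b: "b \<in> children d P" and e: "?f a = ?f b"
    have l: "length (snd a) = d" "length (snd b) = d" "fst a = fst b"
      using a b by (auto simp: children_def)
    have "snd a ! i = snd b ! i" if "i < d" for i
    proof -
      have "snd a ! i mod 2 = snd b ! i mod 2"
        using arg_cong[OF e, of "\<lambda>l. l ! i"] that l by simp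
      moreover have "snd a ! i div 2 = snd b ! i div 2"
        using a b that by (auto simp: children_def)
      ultimately show ?thesis
        by (metis div_mult_mod_eq)
    qed
    then show "a = b"
      using l by (auto simp: prod_eq_iff intro: nth_equalityI)
  qed
  have sub: "?f ` children d P \<subseteq> ?L"
    by (auto simp: children_def)
  have fin: "finite ?L"
    by (rule finite_lists_length_eq) simp
  have "card ?L = 2 ^ d"
    by (subst card_lists_length_eq) (auto simp: numeral_2_eq_2)
  then show ?thesis
    using card_inj_on_le[OF inj sub fin] inj_on_finite[OF inj sub fin] by simp
qed

section \<open>Correspondence between quadtrees and sets of internal nodes\<close>

lemma tree_of_mono: "I \<subseteq> J \<Longrightarrow> tree_of d I \<subseteq> tree_of d J"
  by (auto simp: tree_of_def)

lemma tree_of_valid: "c \<in> tree_of d I \<Longrightarrow> valid_cell d c"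
  by (auto simp: tree_of_def)

lemma node_closed_parent_pow: "node_closed d I \<Longrightarrow> c \<in> I \<Longrightarrow> (parent ^^ t) c \<in> I"
  by (induction t) (auto simp: node_closed_def)

lemma node_closed_subset_tree_of: "node_closed d I \<Longrightarrow> I \<subseteq> tree_of d I"
  by (auto simp: tree_of_def node_closed_def)

text \<open>Presence of a child depends on its parent alone, so siblings appear together and the
  leaves are the cells of the tree outside \<open>I\<close>.\<close>

lemma child_in_tree_of_iff:
  assumes "valid_cell d P" "c \<in> children d P"
  shows "c \<in> tree_of d I \<longleftrightarrow> P \<in> I"
  using assms by (auto simp: tree_of_def children_iff)

lemma leaf_tree_of_iff: "leaf d (tree_of d I) c \<longleftrightarrow> c \<in> tree_of d I \<and> c \<notin> I"
  using children_ne[of d c] child_in_tree_of_iff[of d c _ I] tree_of_valid[of c d I]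
  by (auto simp: leaf_def)

lemma tree_of_insert:
  assumes "valid_cell d P" "P \<in> tree_of d I"
  shows "tree_of d (insert P I) = tree_of d I \<union> children d P"
proof -
  \<comment> \<open>The only cell with parent \<open>P\<close> that is not a child of
    \<open>P\<close> is the root, and the root is in every tree.\<close>
  have "c \<in> tree_of d I" if "valid_cell d c" "parent c = P" "\<not> c \<in> children d P" for c
  proof -
    have "fst c = 0" using that assms by (auto simp: children_iff)
    then have "c = root_cell d" using that valid_level_0 by blast
    then show ?thesis by (simp add: tree_of_def)
  qed
  then show ?thesis
    unfolding set_eq_iff Un_iff children_iff[OF assms(1)]
    by (auto simp: tree_of_def children_iff[OF assms(1)] simp del: split_paired_All)
qed

lemma quadtree_tree_of:
  assumes "node_closed d I"
  shows "quadtree d (tree_of d I)"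
proof -
  have "tree_of d I \<subseteq> insert (root_cell d) (\<Union>P\<in>I. children d P)"
  proof
    fix c assume c: "c \<in> tree_of d I"
    show "c \<in> insert (root_cell d) (\<Union>P\<in>I. children d P)"
    proof (cases "fst c = 0")
      case True
      then show ?thesis using c valid_level_0 tree_of_valid by blast
    next
      case False
      then have "valid_cell d c" "parent c \<in> I" using c by (auto simp: tree_of_def)
      then have "c \<in> children d (parent c)" using False by (simp add: children_iff valid_parent)
      then show ?thesis using \<open>parent c \<in> I\<close> by blast
    qed
  qed
  moreover have "finite (insert (root_cell d) (\<Union>P\<in>I. children d P))"
    using assms finite_children_card_le by (auto simp: node_closed_def)
  ultimately have "finite (tree_of d I)"
    by (rule finite_subset)
  moreover have "parent c \<in> tree_of d I" if "c \<in> tree_of d I" for c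
    using that assms by (auto simp: tree_of_def node_closed_def)
  moreover have "children d c \<subseteq> tree_of d I"
    if "c \<in> tree_of d I" "children d c \<inter> tree_of d I \<noteq> {}" for c
    using that child_in_tree_of_iff[of d c _ I] tree_of_valid[of c d I] by auto
  moreover have "root_cell d \<in> tree_of d I" by (simp add: tree_of_def)
  ultimately show ?thesis
    unfolding quadtree_def using tree_of_valid by blast
qed

text \<open>Take for \<open>I\<close> the cells of \<open>Q\<close> that have all their children in
  \<open>Q\<close>. The all-or-none condition on children puts the parent of every non-root cell of
  \<open>Q\<close> into \<open>I\<close>.\<close>

lemma quadtree_obtain_nodes:
  assumes "quadtree d Q"
  obtains I where "node_closed d I" "Q = tree_of d I"
proof
  define I where "I = {c\<in>Q. children d c \<subseteq> Q}"
  note q = assms[unfolded quadtree_def]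
  have val: "valid_cell d c" if "c \<in> Q" for c
    using q that by blast
  have par: "parent c \<in> I" if "c \<in> Q" "fst c > 0" for c
  proof -
    have "parent c \<in> Q" using q that by blast
    moreover have "c \<in> children d (parent c)"
      using that by (simp add: children_iff val valid_parent)
    ultimately show ?thesis
      using q that unfolding I_def by blast
  qed
  show "node_closed d I"
    unfolding node_closed_def
  proof (intro conjI ballI)
    show "finite I" using q by (auto simp: I_def)
  next
    fix c assume c: "c \<in> I"
    then show "valid_cell d c" using val by (auto simp: I_def)
    then show "parent c \<in> I"
      using c par[of c] valid_level_0[of d c] by (cases "fst c = 0") (auto simp: I_def)
  qed
  show "Q = tree_of d I"
  proof
    show "Q \<subseteq> tree_of d I"
      using par val valid_level_0 by (fastforce simp: tree_of_def)
    show "tree_of d I \<subseteq> Q"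
    proof
      fix c assume "c \<in> tree_of d I"
      then consider "c = root_cell d" | "valid_cell d c" "parent c \<in> I" "fst c > 0"
        unfolding tree_of_def using valid_level_0[of d c] by blast
      then show "c \<in> Q"
      proof cases
        case 2
        then have "c \<in> children d (parent c)"
          by (simp add: children_iff valid_parent)
        then show ?thesis using 2 by (auto simp: I_def)
      qed (use q in auto)
    qed
  qed
qed

section \<open>Adjacency under parents, and closure of the extension\<close>

lemma adjacent_fst_pos: "adjacent d c c' \<Longrightarrow> fst c > 0"
  by (rule ccontr) (auto simp: adjacent_def valid_cell_iff)

text \<open>Halving sends consecutive integers to equal or consecutive ones and keeps equal
  coordinates equal.\<close>

lemma adjacent_parent:
  assumes "adjacent d c c'"
  shows "parent c' = parent c \<or> adjacent d (parent c) (parent c')"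
proof -
  obtain i where i: "i < d" "snd c' ! i = Suc (snd c ! i) \<or> snd c ! i = Suc (snd c' ! i)"
    "\<forall>k<d. k \<noteq> i \<longrightarrow> snd c' ! k = snd c ! k"
    and v: "valid_cell d c" "valid_cell d c'" "fst c = fst c'"
    using assms by (auto simp: adjacent_def)
  have l: "length (snd c) = d" "length (snd c') = d"
    using v by (auto simp: valid_cell_iff)
  have eq: "snd (parent c') ! k = snd (parent c) ! k" if "k < d" "k \<noteq> i" for k
    using i that l by (simp add: nth_parent)
  show ?thesis
  proof (cases "snd c ! i div 2 = snd c' ! i div 2")
    case True
    have "parent c' = parent c"
      by (rule cell_eqI[of d]) (use True eq v l in \<open>auto simp: valid_parent nth_parent\<close>, metis)
    then show ?thesis ..
  next
    case False
    then have "snd c' ! i div 2 = Suc (snd c ! i div 2) \<or> snd c ! i div 2 = Suc (snd c' ! i div 2)"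
      using i(2) div_Suc[of "snd c ! i" 2] div_Suc[of "snd c' ! i" 2] by (auto split: if_splits)
    then have "adjacent d (parent c) (parent c')"
      unfolding adjacent_def using eq v l i(1) by (auto simp: valid_parent nth_parent)
    then show ?thesis ..
  qed
qed

lemma finite_adjacent: "finite {c'. adjacent d c c'}"
proof -
  have "{c'. adjacent d c c'} \<subseteq> {fst c} \<times> {xs. set xs \<subseteq> {..<2 ^ fst c} \<and> length xs = d}"
    by (auto simp: adjacent_def valid_cell_def)
  moreover have "finite \<dots>"
    by (intro finite_cartesian_product finite_lists_length_eq) auto
  ultimately show ?thesis by (rule finite_subset)
qed

text \<open>If \<open>parent P\<close> and \<open>parent P'\<close> are adjacent, this pair requests
  the parent of the node added for \<open>P\<close> and \<open>P'\<close>. If they coincide, that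
  parent is an ancestor of \<open>P\<close> and already present.\<close>

lemma node_closed_ext_nodes: "node_closed d I \<Longrightarrow> node_closed d (ext_nodes d j I)"
proof (induction j)
  case (Suc j)
  let ?E = "ext_nodes d j I"
  have IH: "node_closed d ?E" using Suc by simp
  let ?N = "{(parent ^^ Suc j) P' | P P'. P \<in> ?E \<and> adjacent d P P'}"
  have "?N = (\<Union>P\<in>?E. (parent ^^ Suc j) ` {P'. adjacent d P P'})"
    by blast
  then have "finite ?N"
    using IH finite_adjacent by (auto simp: node_closed_def)
  moreover have "valid_cell d c \<and> parent c \<in> ?E \<union> ?N" if c: "c \<in> ?N" for c
  proof -
    obtain P P' where P: "P \<in> ?E" "adjacent d P P'" "c = (parent ^^ Suc j) P'"
      using c by blast
    have pc: "parent c = (parent ^^ Suc j) (parent P')"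
      using P(3) by (simp add: funpow_swap1)
    have pP: "parent P \<in> ?E" using IH P by (auto simp: node_closed_def)
    from adjacent_parent[OF P(2)] have "parent c \<in> ?E \<union> ?N"
    proof
      assume "parent P' = parent P"
      then have "parent c \<in> ?E" unfolding pc by (simp only: node_closed_parent_pow[OF IH pP])
      then show ?thesis ..
    next
      assume "adjacent d (parent P) (parent P')"
      then show ?thesis using pP pc by blast
    qed
    moreover have "valid_cell d c"
      using P valid_parent_pow[of d P' "Suc j"] by (auto simp: adjacent_def)
    ultimately show ?thesis by blast
  qed
  ultimately show ?case
    using IH by (fastforce simp: node_closed_def)
qed simp

subsection \<open>Smoothness in terms of ancestors of adjacent cells\<close>

lemma cell_size_le_iff: "cell_size n \<le> 2 ^ s * cell_size c \<longleftrightarrow> fst c \<le> fst n + s"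
proof -
  have "cell_size n \<le> 2 ^ s * cell_size c \<longleftrightarrow> (2::real) ^ fst c \<le> 2 ^ (fst n + s)"
    by (simp add: cell_size_def power_divide field_simps power_add)
  also have "\<dots> \<longleftrightarrow> fst c \<le> fst n + s"
    by simp
  finally show ?thesis .
qed

text \<open>With \<open>c\<close> finer by \<open>t\<close> levels, multiplying by
  \<open>2 ^ fst c\<close> turns all comparisons of box sides into integer ones.\<close>

lemma lo_hi_iff:
  assumes "fst c = fst n + t"
  shows "lo c i < hi n i \<longleftrightarrow> snd c ! i < (snd n ! i + 1) * 2 ^ t"
    and "lo n i < hi c i \<longleftrightarrow> snd n ! i * 2 ^ t < snd c ! i + 1"
    and "hi c i = lo n i \<longleftrightarrow> snd c ! i + 1 = snd n ! i * 2 ^ t"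
    and "hi n i = lo c i \<longleftrightarrow> (snd n ! i + 1) * 2 ^ t = snd c ! i"
proof -
  have r: "real a < real b \<longleftrightarrow> a < b" "real a = real b \<longleftrightarrow> a = b" for a b by auto
  have e: "a / 2 ^ fst c = b / 2 ^ fst n \<longleftrightarrow> a = b * 2 ^ t" for a b :: real
    by (simp add: assms power_add nonzero_divide_eq_eq eq_divide_eq mult.commute)
  show "lo c i < hi n i \<longleftrightarrow> snd c ! i < (snd n ! i + 1) * 2 ^ t"
    unfolding r(1)[symmetric] by (simp add: assms lo_def hi_def field_simps power_add)
  show "lo n i < hi c i \<longleftrightarrow> snd n ! i * 2 ^ t < snd c ! i + 1"
    unfolding r(1)[symmetric] by (simp add: assms lo_def hi_def field_simps power_add)
  show "hi c i = lo n i \<longleftrightarrow> snd c ! i + 1 = snd n ! i * 2 ^ t"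
    unfolding r(2)[symmetric] by (simp add: e lo_def hi_def add.commute)
  show "hi n i = lo c i \<longleftrightarrow> (snd n ! i + 1) * 2 ^ t = snd c ! i"
    unfolding r(2)[symmetric] 
    by (subst eq_commute) (simp add: e lo_def hi_def eq_commute algebra_simps)
qed

text \<open>Read with \<open>lo_hi_iff\<close>: a fine interval overlaps a coarse one iff division
  maps its coordinate to the coarse one.\<close>

lemma div_eq_iff_bounds: "(0::nat) < m \<Longrightarrow> x div m = y \<longleftrightarrow> x < (y + 1) * m \<and> y * m < x + 1"
  by (auto simp: div_nat_eqI less_Suc_eq_le mult.commute dividend_less_times_div)

text \<open>Crossing the shared facet from \<open>c\<close> by one step of its own size leads to a
  cell \<open>c'\<close> inside \<open>n\<close>, which is at least as large as
  \<open>c\<close>.\<close>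

lemma neighbors_imp_adjacent:
  assumes c: "valid_cell d c" and n: "valid_cell d n" and t: "fst c = fst n + t"
    and nb: "neighbors d c n"
  obtains c' where "adjacent d c c'" "(parent ^^ t) c' = n"
proof -
  obtain j where j: "j < d"
    and touch: "snd c ! j + 1 = snd n ! j * 2 ^ t \<or> (snd n ! j + 1) * 2 ^ t = snd c ! j"
    and rest: "\<And>i. i < d \<Longrightarrow> i \<noteq> j \<Longrightarrow> snd c ! i div 2 ^ t = snd n ! i"
    using nb unfolding neighbors_def lo_hi_iff[OF t] by (auto simp: div_eq_iff_bounds)
  have l: "length (snd c) = d" "length (snd n) = d"
    using c n by (auto simp: valid_cell_iff)
  have nj: "Suc (snd n ! j) \<le> 2 ^ fst n"
    using n j by (auto simp: valid_cell_iff Suc_le_eq)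
  \<comment> \<open>The touching coordinate after the step across the facet, upwards or
    downwards.\<close>
  define z where "z = (if snd c ! j + 1 = snd n ! j * 2 ^ t then snd c ! j + 1 else snd c ! j - 1)"
  have z: "z div 2 ^ t = snd n ! j" "z = Suc (snd c ! j) \<or> snd c ! j = Suc z"
  proof -
    show "z div 2 ^ t = snd n ! j"
    proof (cases "snd c ! j + 1 = snd n ! j * 2 ^ t")
      case False
      then have e: "snd c ! j = snd n ! j * 2 ^ t + 2 ^ t" using touch by simp
      have "(0::nat) < 2 ^ t" by simp
      then have "snd c ! j - 1 < (snd n ! j + 1) * 2 ^ t" "snd n ! j * 2 ^ t < snd c ! j - 1 + 1"
        unfolding e by (simp_all add: algebra_simps)
      then show ?thesis using False by (simp add: z_def div_eq_iff_bounds)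
    qed (simp add: z_def)
    \<comment> \<open>Positivity makes the truncated \<open>snd c ! j - 1\<close> a genuine
      predecessor.\<close>
    have "snd c ! j > 0" if "(snd n ! j + 1) * 2 ^ t = snd c ! j"
      using that[symmetric] by simp
    then show "z = Suc (snd c ! j) \<or> snd c ! j = Suc z"
      using touch by (auto simp: z_def)
  qed
  have "z < Suc (snd n ! j) * 2 ^ t"
    using z(1) div_eq_iff_bounds[of "2 ^ t" z "snd n ! j"] by simp
  also have "\<dots> \<le> 2 ^ fst c"
    using mult_right_mono[OF nj, of "2 ^ t"] t by (simp add: power_add)
  finally have zb: "z < 2 ^ fst c" .
  define c' where "c' = (fst c, (snd c)[j := z])"
  have c': "valid_cell d c'"
    using c zb j unfolding valid_cell_iff by (auto simp: c'_def nth_list_update)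
  have "adjacent d c c'"
    unfolding adjacent_def using c c' z(2) j l
    by (auto simp: c'_def nth_list_update intro!: exI[of _ j])
  moreover have "(parent ^^ t) c' = n"
  proof (rule cell_eqI[of d])
    show "valid_cell d ((parent ^^ t) c')" using c' by (rule valid_parent_pow)
    show "snd ((parent ^^ t) c') ! i = snd n ! i" if "i < d" for i
      using that z(1) rest l by (cases "i = j") (auto simp: parent_pow_eq c'_def)
  qed (use n t in \<open>auto simp: parent_pow_eq c'_def\<close>)
  ultimately show thesis by (rule that)
qed

text \<open>An ancestor of \<open>c'\<close> meets \<open>c\<close> in a facet unless it contains
  \<open>c\<close>. The bound on \<open>t\<close> makes the difference of levels exactly
  \<open>t\<close>.\<close>

lemma adjacent_imp_neighbors:
  assumes adj: "adjacent d c c'" and t: "t \<le> fst c"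
    and ne: "(parent ^^ t) c' \<noteq> (parent ^^ t) c"
  shows "neighbors d c ((parent ^^ t) c')"
proof -
  let ?n = "(parent ^^ t) c'"
  obtain i where i: "i < d" "snd c' ! i = Suc (snd c ! i) \<or> snd c ! i = Suc (snd c' ! i)"
    "\<And>k. k < d \<Longrightarrow> k \<noteq> i \<Longrightarrow> snd c' ! k = snd c ! k"
    and v: "valid_cell d c" "valid_cell d c'" "fst c = fst c'"
    using adj by (auto simp: adjacent_def)
  have l: "length (snd c) = d" "length (snd c') = d"
    using v by (auto simp: valid_cell_iff)
  have lev: "fst c = fst ?n + t" using v t by (simp add: parent_pow_eq)
  have co: "snd ?n ! k = snd c' ! k div 2 ^ t" if "k < d" for k
    using l that by (simp add: parent_pow_eq)
  have "snd c ! i div 2 ^ t \<noteq> snd c' ! i div 2 ^ t"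
  proof
    assume e: "snd c ! i div 2 ^ t = snd c' ! i div 2 ^ t"
    have "snd c ! k div 2 ^ t = snd c' ! k div 2 ^ t" if "k < d" for k
      using e i(3)[of k] that by (cases "k = i") auto
    then have "?n = (parent ^^ t) c"
      using v l by (auto simp: parent_pow_eq intro!: nth_equalityI)
    then show False using ne by simp
  qed
  moreover have "Suc x = Suc x div m * m" if "x div m \<noteq> Suc x div m" for x m :: nat
    \<comment> \<open>Of two consecutive integers with different quotients the larger is a multiple
      of \<open>m\<close>. So the facet between \<open>c\<close> and \<open>c'\<close> lies on the
      boundary of the ancestor.\<close>
    using that div_Suc[of x m] by (auto split: if_splits)
  moreover have "Suc x div m = x div m + 1" if "x div m \<noteq> Suc x div m" for x m :: nat
    using that div_Suc[of x m] by (auto split: if_splits)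
  ultimately have "snd c ! i + 1 = snd ?n ! i * 2 ^ t \<or> (snd ?n ! i + 1) * 2 ^ t = snd c ! i"
    using i(1,2) unfolding co[OF i(1)] by (metis Suc_eq_plus1)
  then show ?thesis
    unfolding neighbors_def lo_hi_iff[OF lev]
    using i(1,3) co div_eq_iff_bounds[of "2 ^ t"] by (metis zero_less_power pos2)
qed


text \<open>A neighbouring leaf that is too large would be an ancestor of some adjacent
  \<open>c'\<close> at a height above \<open>s\<close>. But all ancestors above a cell of the tree
  are internal.\<close>

lemma smooth_tree_ofI:
  assumes c: "c \<in> tree_of d K" and K: "node_closed d K"
    and anc: "\<And>c'. adjacent d c c' \<Longrightarrow> (parent ^^ s) c' \<in> tree_of d K"
  shows "smooth d (tree_of d K) s c"
  unfolding smooth_def cell_size_le_iff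
proof (intro allI impI, rule ccontr)
  fix n assume n: "leaf d (tree_of d K) n \<and> neighbors d c n" and "\<not> fst c \<le> fst n + s"
  then obtain t where t: "fst c = fst n + (s + Suc t)"
    by (metis add.assoc less_imp_Suc_add not_le add_Suc_right)
  have nK: "n \<in> tree_of d K" "n \<notin> K" using n by (auto simp: leaf_tree_of_iff)
  obtain c' where c': "adjacent d c c'" "(parent ^^ (s + Suc t)) c' = n"
    using neighbors_imp_adjacent[OF tree_of_valid[OF c] tree_of_valid[OF nK(1)] t] n by blast
  let ?a = "(parent ^^ s) c'"
  have "fst ?a = fst c - s" using c'(1) by (auto simp: parent_pow_eq adjacent_def)
  then have "fst ?a > 0" using t by simp
  then have "parent ?a \<in> K" using anc[OF c'(1)] by (auto simp: tree_of_def)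
  then have "(parent ^^ t) (parent ?a) \<in> K" by (rule node_closed_parent_pow[OF K])
  moreover have "(parent ^^ t) (parent ?a) = (parent ^^ (Suc t + s)) c'"
    by (simp add: funpow_add funpow_swap1)
  ultimately show False using c'(2) nK(2) by (simp only: add.commute)
qed

text \<open>If the ancestor of \<open>c'\<close> at height \<open>s\<close> is missing, the lowest
  ancestor present above it is a leaf, a neighbour of \<open>c\<close>, and too large.\<close>

lemma smooth_tree_ofD:
  assumes c: "c \<in> tree_of d K" and K: "node_closed d K"
    and sm: "smooth d (tree_of d K) s c" and adj: "adjacent d c c'"
  shows "(parent ^^ s) c' \<in> tree_of d K"
proof (rule ccontr)
  assume no: "(parent ^^ s) c' \<notin> tree_of d K"
  have v: "valid_cell d c'" "fst c' = fst c" using adj by (auto simp: adjacent_def)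
  define P where "P t \<longleftrightarrow> s < t \<and> (parent ^^ t) c' \<in> tree_of d K" for t
  \<comment> \<open>From height \<open>fst c'\<close> on the ancestors are the root, which is in the
    tree, so a least height \<open>t\<close> exists.\<close>
  have root: "(parent ^^ t) c' = root_cell d" if "fst c' \<le> t" for t
    by (rule valid_level_0) (use that v in \<open>auto simp: valid_parent_pow\<close>, simp add: parent_pow_eq)
  have rt: "root_cell d \<in> tree_of d K" by (simp add: tree_of_def)
  have sc: "s < fst c'"
    using no root[of s] rt by (metis not_le)
  have Pc: "P (fst c')" using sc root[of "fst c'"] rt by (simp add: P_def)
  define t where "t = (LEAST t. P t)"
  have Pt: "P t" unfolding t_def by (rule LeastI[of P, OF Pc])
  have tc: "t \<le> fst c'" unfolding t_def by (rule Least_le[of P, OF Pc])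
  obtain u where u: "t = Suc u" "s \<le> u" using Pt by (cases t) (auto simp: P_def)
  have "\<not> P u" using not_less_Least[of u P] u(1) by (auto simp: t_def)
  then have nu: "(parent ^^ u) c' \<notin> tree_of d K"
    using no u(2) by (cases "u = s") (auto simp: P_def)
  let ?n = "(parent ^^ t) c'"
  have nin: "?n \<in> tree_of d K" using Pt by (simp add: P_def)
  have "?n \<notin> K"
    using nu valid_parent_pow[OF v(1), of u] u(1) by (auto simp: tree_of_def)
  then have lf: "leaf d (tree_of d K) ?n" using nin by (simp add: leaf_tree_of_iff)
  \<comment> \<open>The proper ancestors of \<open>c\<close> are internal, so the leaf
    \<open>?n\<close> is none of them and must be a neighbour.\<close>
  have "parent c \<in> K"
    using c adjacent_fst_pos[OF adj] by (auto simp: tree_of_def)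
  then have "(parent ^^ u) (parent c) \<in> K" by (rule node_closed_parent_pow[OF K])
  then have "(parent ^^ t) c \<in> K" by (simp add: u(1) funpow_swap1)
  then have "?n \<noteq> (parent ^^ t) c" using \<open>?n \<notin> K\<close> by metis
  then have "neighbors d c ?n"
    using adjacent_imp_neighbors[OF adj] tc v(2) by simp
  then have "fst c \<le> fst ?n + s"
    using sm lf unfolding smooth_def cell_size_le_iff by blast
  then show False using tc v(2) u by (simp add: parent_pow_eq)
qed

text \<open>Needed because \<open>smooth\<close> constrains cells, whereas \<open>ext_nodes\<close>
  speaks of internal nodes. Two children touching the common facet carry the adjacency over.\<close>

lemma exists_child_adjacent:
  assumes "adjacent d P P'"
  obtains c c' where "adjacent d c c'" "parent c = P" "parent c' = P'" "c \<in> children d P"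
proof -
  obtain i where i: "i < d" "snd P' ! i = Suc (snd P ! i) \<or> snd P ! i = Suc (snd P' ! i)"
    "\<And>k. k < d \<Longrightarrow> k \<noteq> i \<Longrightarrow> snd P' ! k = snd P ! k"
    and v: "valid_cell d P" "valid_cell d P'" "fst P = fst P'"
    using assms by (auto simp: adjacent_def)
  define up where "up \<longleftrightarrow> snd P' ! i = Suc (snd P ! i)"
  \<comment> \<open>In direction \<open>i\<close> the lower of the two parents takes its upper half
    and the other its lower half; elsewhere both take the lower half.\<close>
  define c where "c = (Suc (fst P), map (\<lambda>k. 2 * snd P ! k + (if k = i \<and> up then 1 else 0)) [0..<d])"
  define c' where "c' = (Suc (fst P), map (\<lambda>k. 2 * snd P' ! k + (if k = i \<and> \<not> up then 1 else 0)) [0..<d])"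
  have ch: "c \<in> children d P" "c' \<in> children d P'"
    using v by (auto simp: children_def c_def c'_def)
  have "adjacent d c c'"
    unfolding adjacent_def
  proof (intro conjI exI[of _ i] allI impI)
    show "valid_cell d c" "valid_cell d c'" using ch v by (auto simp: children_iff)
  qed (use i in \<open>auto simp: c_def c'_def up_def\<close>)
  then show thesis using that ch v by (auto simp: children_iff)
qed

text \<open>Only cells of brand exactly \<open>Suc i\<close> are required to be smooth. For a node of smaller brand the
  cell demanded by \<^const>\<open>ext_nodes\<close> is the parent of one already added in the previous step.\<close>

lemma ext_tree_of: "node_closed d I \<Longrightarrow> ext d (tree_of d I) (Suc j) = tree_of d (ext_nodes d j I)"
\<comment> \<open>Strong induction, since the set of cells of the newest brand involves the two
  preceding stages.\<close>
proof (induction j rule: less_induct)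
  case (less j)
  note I = less.prems
  show ?case
  proof (cases j)
    case (Suc i)
    let ?E = "ext_nodes d i I" and ?F = "ext_nodes d (Suc i) I"
    let ?Y = "ext d (tree_of d I) i"
    have X: "ext d (tree_of d I) (Suc i) = tree_of d ?E"
      using less Suc by simp
    have E: "node_closed d ?E" and F: "node_closed d ?F"
      using I by (rule node_closed_ext_nodes)+
    let ?S = "{Q. quadtree d Q \<and> tree_of d ?E \<subseteq> Q \<and> (\<forall>c \<in> tree_of d ?E - ?Y. smooth d Q (Suc i) c)}"
    have sub: "tree_of d ?E \<subseteq> tree_of d ?F" by (rule tree_of_mono) auto
    \<comment> \<open>Shown for every cell of the stage, whatever its brand: the parents of
      \<open>c\<close> and \<open>c'\<close> coincide or form a pair as in the definition of
      \<open>?F\<close>.\<close>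
    have "smooth d (tree_of d ?F) (Suc i) c" if c: "c \<in> tree_of d ?E" for c
    proof (rule smooth_tree_ofI[OF _ F])
      show "c \<in> tree_of d ?F" using c sub by blast
      fix c' assume adj: "adjacent d c c'"
      have pE: "parent c \<in> ?E"
        using c adjacent_fst_pos[OF adj] by (auto simp: tree_of_def)
      let ?a = "(parent ^^ Suc i) c'"
      have va: "valid_cell d ?a"
        using adj by (intro valid_parent_pow) (simp add: adjacent_def)
      have pa: "parent ?a = (parent ^^ Suc i) (parent c')" by (simp add: funpow_swap1)
      from adjacent_parent[OF adj] have "parent ?a \<in> ?F"
      proof
        assume "parent c' = parent c"
        then have "parent ?a \<in> ?E" unfolding pa by (simp only: node_closed_parent_pow[OF E pE])
        then show ?thesis by simp
      next
        assume "adjacent d (parent c) (parent c')"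
        then show ?thesis unfolding pa ext_nodes.simps using pE by blast
      qed
      then show "?a \<in> tree_of d ?F" using va by (auto simp: tree_of_def)
    qed
    then have "tree_of d ?F \<in> ?S" using quadtree_tree_of[OF F] sub by blast
    \<comment> \<open>Minimality: every node of \<open>?F\<close> must be internal in any admissible
      \<open>Q\<close>.\<close>
    moreover have "tree_of d ?F \<subseteq> Q" if Q: "Q \<in> ?S" for Q
    proof -
      obtain K where K: "node_closed d K" "Q = tree_of d K"
        using Q quadtree_obtain_nodes by blast
      have EK: "P \<in> K" if P: "P \<in> ?E" for P
      proof -
        have vP: "valid_cell d P" using P E by (auto simp: node_closed_def)
        obtain c where c: "c \<in> children d P" using children_ne[of d P] by blast
        then have "c \<in> tree_of d ?E" using P vP child_in_tree_of_iff by blast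
        then show ?thesis using Q K(2) c vP child_in_tree_of_iff by blast
      qed
      have "(parent ^^ Suc i) P' \<in> K" if P: "P \<in> ?E" and adj: "adjacent d P P'" for P P'
      proof (cases "i > 0 \<and> P \<in> ext_nodes d (i - 1) I")
        case True
        then have "(parent ^^ i) P' \<in> ?E" using adj by (cases i) auto
        then show ?thesis using K(1) EK by (auto simp: node_closed_def)
      next
        case False
        obtain c c' where c: "adjacent d c c'" "parent c = P" "parent c' = P'" "c \<in> children d P"
          using exists_child_adjacent[OF adj] by blast
        have vP: "valid_cell d P" using adj by (simp add: adjacent_def)
        have cX: "c \<in> tree_of d ?E" using child_in_tree_of_iff[OF vP c(4)] P by blast
        \<comment> \<open>\<open>c\<close> has the newest brand because its parent \<open>P\<close>
          is not a node of the preceding stage; for \<open>i = 0\<close> that stage is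
          empty.\<close>
        have cY: "c \<notin> ?Y"
        proof (cases i)
          case (Suc k)
          then have "?Y = tree_of d (ext_nodes d k I)" using less \<open>j = Suc i\<close> by simp
          then show ?thesis using False Suc child_in_tree_of_iff[OF vP c(4)] by simp
        qed simp
        have "smooth d (tree_of d K) (Suc i) c" using Q cX cY K(2) by blast
        moreover have "c \<in> tree_of d K" using child_in_tree_of_iff[OF vP c(4)] P EK by blast
        ultimately have "(parent ^^ Suc i) c' \<in> tree_of d K"
          using smooth_tree_ofD K(1) c(1) by blast
        moreover have "(parent ^^ Suc i) c' = (parent ^^ i) P'"
          using c(3) by (simp add: funpow_swap1)
        ultimately have "(parent ^^ i) P' \<in> tree_of d K" by simp
        then consider "(parent ^^ i) P' = root_cell d" | "parent ((parent ^^ i) P') \<in> K"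
          by (auto simp: tree_of_def)
        then show ?thesis
        proof cases
          case 1
          \<comment> \<open>At the root, \<open>parent\<close> changes nothing, and the root is
            internal as an ancestor of \<open>P\<close>.\<close>
          have "(parent ^^ fst P) P \<in> K" by (rule node_closed_parent_pow[OF K(1) EK[OF P]])
          moreover have "(parent ^^ fst P) P = root_cell d"
            by (rule valid_level_0[OF valid_parent_pow[OF vP]]) (simp add: parent_pow_eq)
          ultimately show ?thesis using 1 by simp
        qed simp
      qed
      then have "?F \<subseteq> K" using EK by auto
      then show ?thesis unfolding K(2) by (rule tree_of_mono)
    qed
    ultimately have "\<Inter> ?S = tree_of d ?F" by blast
    then show ?thesis using X Suc by simp
  qed simp
qed

subsection \<open>Nodes affected by a single split\<close>

definition outer_adjacent :: "nat \<Rightarrow> cell \<Rightarrow> cell set" where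
  "outer_adjacent d P = {P'. adjacent d P P' \<and> parent P' \<noteq> parent P}"

text \<open>Only one of the two integers next to \<open>p\<close> has a half different from that of
  \<open>p\<close>.\<close>

lemma eq_if_div2_differs_same_side:
  fixes a b p :: nat
  assumes "a = Suc p \<or> p = Suc a" "b = Suc p \<or> p = Suc b" "a div 2 \<noteq> p div 2" "b div 2 \<noteq> p div 2"
  shows "a = b"
  using assms by (cases "even p") (auto elim!: evenE oddE)

text \<open>Each coordinate axis contributes at most one outer neighbour, since the parity of the
  coordinate decides on which side the sibling lies.\<close>

lemma finite_outer_adjacent_card_le: "finite (outer_adjacent d P) \<and> card (outer_adjacent d P) \<le> d"
proof -
  let ?R = "\<lambda>P' i. (snd P' ! i = Suc (snd P ! i) \<or> snd P ! i = Suc (snd P' ! i)) \<and>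
    (\<forall>k<d. k \<noteq> i \<longrightarrow> snd P' ! k = snd P ! k)"
  define f where "f P' = (SOME i. i < d \<and> ?R P' i)" for P' :: cell
  have f: "f P' < d \<and> ?R P' (f P')" if "P' \<in> outer_adjacent d P" for P'
  proof -
    have "\<exists>i. i < d \<and> ?R P' i"
      using that unfolding outer_adjacent_def adjacent_def by blast
    then show ?thesis unfolding f_def by (rule someI_ex)
  qed
  have par: "snd P' ! f P' div 2 \<noteq> snd P ! f P' div 2" if P': "P' \<in> outer_adjacent d P" for P'
  proof
    assume e: "snd P' ! f P' div 2 = snd P ! f P' div 2"
    have v: "valid_cell d P" "valid_cell d P'" "fst P' = fst P"
      using P' by (auto simp: outer_adjacent_def adjacent_def)
    then have l: "length (snd P) = d" "length (snd P') = d" by (auto simp: valid_cell_iff)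
    have "snd P' ! k div 2 = snd P ! k div 2" if "k < d" for k
      using e f[OF P'] that by (cases "k = f P'") auto
    then have "parent P' = parent P"
      using l v by (auto simp: parent_def intro!: nth_equalityI)
    then show False using P' by (simp add: outer_adjacent_def)
  qed
  have "inj_on f (outer_adjacent d P)"
  proof (rule inj_onI)
    fix A B assume A: "A \<in> outer_adjacent d P" and B: "B \<in> outer_adjacent d P" and e: "f A = f B"
    have "snd A ! f A = snd B ! f A"
      using f[OF A] f[OF B] par[OF A] par[OF B] unfolding e by (intro eq_if_div2_differs_same_side[of _ "snd P ! f B"]) auto
    then have "snd A ! k = snd B ! k" if "k < d" for k
      using f[OF A] f[OF B] that e by (cases "k = f A") auto
    then show "A = B"
      using A B by (intro cell_eqI[of d]) (auto simp: outer_adjacent_def adjacent_def)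
  qed
  moreover have "f ` outer_adjacent d P \<subseteq> {..<d}" using f by auto
  ultimately show ?thesis
    using card_inj_on_le[of f _ "{..<d}"] inj_on_finite[of f _ "{..<d}"] by auto
qed

text \<open>Follows the recursion of \<open>ext_nodes\<close> from the single node \<open>c\<close>,
  over outer neighbours only. It does not depend on the tree, so its size bounds the change
  uniformly in \<open>I\<close>.\<close>

fun affected :: "nat \<Rightarrow> cell \<Rightarrow> nat \<Rightarrow> cell set" where
  "affected d c 0 = {c}"
| "affected d c (Suc j) = affected d c j \<union> (\<Union>P\<in>affected d c j. (parent ^^ Suc j) ` outer_adjacent d P)"

lemma finite_affected_card_le: "finite (affected d c j) \<and> card (affected d c j) \<le> (d + 1) ^ j"
proof (induction j)
  case (Suc j)
  let ?A = "affected d c j" and ?N = "\<lambda>P. (parent ^^ Suc j) ` outer_adjacent d P"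
  have fin: "finite ?A" using Suc by simp
  have N: "finite (?N P) \<and> card (?N P) \<le> d" for P
    using finite_outer_adjacent_card_le[of d P] card_image_le[of "outer_adjacent d P" "parent ^^ Suc j"]
    by (meson finite_imageI le_trans)
  have "card (affected d c (Suc j)) \<le> card ?A + card (\<Union>P\<in>?A. ?N P)"
    unfolding affected.simps by (rule card_Un_le)
  also have "\<dots> \<le> card ?A + (\<Sum>P\<in>?A. card (?N P))"
    using card_UN_le[OF fin, of ?N] by simp
  also have "\<dots> \<le> card ?A + (\<Sum>P\<in>?A. d)"
    using N by (intro add_left_mono sum_mono) blast
  also have "\<dots> = (d + 1) * card ?A" by simp
  also have "\<dots> \<le> (d + 1) * (d + 1) ^ j" using Suc by (intro mult_left_mono) auto
  finally have "card (affected d c (Suc j)) \<le> (d + 1) ^ Suc j" by simp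
  moreover have "finite (affected d c (Suc j))"
    unfolding affected.simps using fin N by blast
  ultimately show ?case by simp
qed simp

lemma affected_mono: "j \<le> k \<Longrightarrow> affected d c j \<subseteq> affected d c k"
  by (rule lift_Suc_mono_le) auto

lemma ext_nodes_mono: "I \<subseteq> J \<Longrightarrow> ext_nodes d j I \<subseteq> ext_nodes d j J"
  by (induction j) fastforce+

text \<open>Each new node is the root or has an old parent: by induction \<open>parent P\<close> is
  old, and the argument for closure under parents applies to it. So new nodes are leaves of the old
  extended tree.\<close>

lemma ext_nodes_insert_subset_tree:
  assumes I: "node_closed d I" and c: "c \<in> tree_of d I"
  shows "ext_nodes d j (insert c I) \<subseteq> tree_of d (ext_nodes d j I)"
proof (induction j)
  case 0
  then show ?case using c node_closed_subset_tree_of[OF I] by simp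
next
  case (Suc j)
  let ?E = "ext_nodes d j I"
  have E: "node_closed d ?E" using I by (rule node_closed_ext_nodes)
  have mono: "tree_of d ?E \<subseteq> tree_of d (ext_nodes d (Suc j) I)" by (rule tree_of_mono) auto
  have "(parent ^^ Suc j) P' \<in> tree_of d (ext_nodes d (Suc j) I)"
    if P: "P \<in> ext_nodes d j (insert c I)" and adj: "adjacent d P P'" for P P'
  proof -
    have "P \<in> tree_of d ?E" using Suc P by blast
    then have pE: "parent P \<in> ?E"
      using adjacent_fst_pos[OF adj] by (auto simp: tree_of_def)
    have pa: "parent ((parent ^^ Suc j) P') = (parent ^^ Suc j) (parent P')"
      by (simp add: funpow_swap1)
    from adjacent_parent[OF adj] have "parent ((parent ^^ Suc j) P') \<in> ext_nodes d (Suc j) I"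
    proof
      assume "parent P' = parent P"
      then have "parent ((parent ^^ Suc j) P') \<in> ?E"
        unfolding pa by (simp only: node_closed_parent_pow[OF E pE])
      then show ?thesis by simp
    next
      assume "adjacent d (parent P) (parent P')"
      then show ?thesis unfolding pa ext_nodes.simps using pE by blast
    qed
    moreover have "valid_cell d ((parent ^^ Suc j) P')"
      using adj by (intro valid_parent_pow) (simp add: adjacent_def)
    ultimately show ?thesis by (auto simp: tree_of_def)
  qed
  then show ?case using Suc mono unfolding ext_nodes.simps(2)[of d j "insert c I"] by blast
qed

text \<open>A new node can only be requested by a new \<open>P\<close>, as an old one would have
  requested it before. It cannot come from a sibling \<open>P'\<close>, since then it would be an
  ancestor of the old node \<open>parent P\<close>.\<close>

lemma ext_nodes_insert_diff_affected:
  assumes I: "node_closed d I" and c: "c \<in> tree_of d I"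
  shows "ext_nodes d j (insert c I) - ext_nodes d j I \<subseteq> affected d c j"
proof (induction j)
  case (Suc j)
  let ?E = "ext_nodes d j I" and ?E' = "ext_nodes d j (insert c I)"
  have E: "node_closed d ?E" using I by (rule node_closed_ext_nodes)
  have "(parent ^^ Suc j) P' \<in> affected d c (Suc j)"
    if P: "P \<in> ?E'" and adj: "adjacent d P P'" and new: "(parent ^^ Suc j) P' \<notin> ext_nodes d (Suc j) I"
    for P P'
  proof -
    have "P \<notin> ?E" using new adj unfolding ext_nodes.simps by blast
    then have PA: "P \<in> affected d c j" using Suc P by blast
    have "P \<in> tree_of d ?E" using ext_nodes_insert_subset_tree[OF I c] P by blast
    then have pE: "parent P \<in> ?E"
      using adjacent_fst_pos[OF adj] by (auto simp: tree_of_def)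
    have "parent P' \<noteq> parent P"
    proof
      assume "parent P' = parent P"
      then have "(parent ^^ Suc j) P' = (parent ^^ j) (parent P)" by (simp add: funpow_swap1)
      then have "(parent ^^ Suc j) P' \<in> ?E" by (simp only: node_closed_parent_pow[OF E pE])
      then show False using new by simp
    qed
    then show ?thesis using PA adj unfolding affected.simps outer_adjacent_def by blast
  qed
  moreover have "x \<in> affected d c (Suc j)" if "x \<in> ?E'" "x \<notin> ext_nodes d (Suc j) I" for x
    using that Suc by auto
  ultimately show ?case unfolding ext_nodes.simps(2)[of d j "insert c I"] by blast
qed auto

subsection \<open>Realising the change by operations\<close>

text \<open>All nodes of \<open>D\<close> are leaves of the initial tree, so no split has to wait
  for another.\<close>

lemma splits_reach:
  assumes "finite D" "D \<inter> J = {}" "D \<subseteq> tree_of d J" "\<forall>c\<in>tree_of d J. b c = b' c"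
  shows "\<exists>b1. (op_step d ^^ card D) (tree_of d J, b) (tree_of d (J \<union> D), b1) \<and>
    (\<forall>c\<in>tree_of d (J \<union> D). b1 c = b' c)"
  using assms
proof (induction D rule: finite_induct)
  case empty
  then show ?case by auto
next
  case (insert P D)
  let ?A = "tree_of d (J \<union> D)"
  obtain b1 where b1: "(op_step d ^^ card D) (tree_of d J, b) (?A, b1)" "\<forall>c\<in>?A. b1 c = b' c"
    using insert by auto
  have PA: "P \<in> ?A" using insert.prems tree_of_mono[of J "J \<union> D" d] by auto
  have "leaf d ?A P" using PA insert by (simp add: leaf_tree_of_iff)
  moreover have "tree_of d (J \<union> insert P D) = ?A \<union> children d P"
    using tree_of_insert[OF tree_of_valid[OF PA] PA] by simp
  ultimately have "split_op d ?A (tree_of d (J \<union> insert P D))"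
    unfolding split_op_def by blast
  \<comment> \<open>A split leaves the brands of the new cells free, so they can be set to
    \<open>b'\<close> in the same operation.\<close>
  then have "op_step d (?A, b1) (tree_of d (J \<union> insert P D), b')"
    using b1(2) by (simp add: op_step_def)
  then have "(op_step d ^^ Suc (card D)) (tree_of d J, b) (tree_of d (J \<union> insert P D), b')"
    using b1(1) by auto
  then show ?case using insert by auto
qed

lemma merges_reach:
  assumes "finite D" "D \<inter> J = {}" "D \<subseteq> tree_of d J" "node_closed d J"
  shows "(op_step d ^^ card D) (tree_of d (J \<union> D), b) (tree_of d J, b)"
  using assms
proof (induction D rule: finite_induct)
  case empty
  then show ?case by auto
next
  case (insert P D)
  let ?A = "tree_of d (J \<union> D)" and ?B = "tree_of d (J \<union> insert P D)"
  have PA: "P \<in> ?A" using insert.prems tree_of_mono[of J "J \<union> D" d] by auto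
  have vP: "valid_cell d P" using PA by (rule tree_of_valid)
  have B: "?B = ?A \<union> children d P"
    using tree_of_insert[OF vP PA] by simp
  have disj: "children d P \<inter> ?A = {}"
    using child_in_tree_of_iff[OF vP, of _ "J \<union> D"] insert by blast
  \<comment> \<open>A child of \<open>P\<close> is not internal: the nodes of \<open>J\<close> and
    \<open>D\<close> are cells of \<open>tree_of d J\<close>, in which \<open>P\<close> is a
    leaf.\<close>
  have "x \<notin> J \<union> insert P D" if x: "x \<in> children d P" for x
  proof -
    have "x \<notin> tree_of d J" using child_in_tree_of_iff[OF vP x, of J] insert.prems by blast
    moreover have "J \<union> insert P D \<subseteq> tree_of d J"
      using node_closed_subset_tree_of insert.prems by blast
    ultimately show ?thesis by blast
  qed
  then have "\<forall>x\<in>children d P. leaf d ?B x" unfolding leaf_tree_of_iff using B by blast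
  then have "merge_op d ?B ?A"
    unfolding merge_op_def using B disj PA by (intro bexI[of _ P]) auto
  then have "op_step d (?B, b) (?A, b)" by (auto simp: op_step_def)
  moreover have "(op_step d ^^ card D) (?A, b) (tree_of d J, b)" using insert by auto
  ultimately have "(op_step d ^^ Suc (card D)) (?B, b) (tree_of d J, b)"
    by (rule relpowp_Suc_I2)
  then show ?case using insert by simp
qed

text \<open>An update outside \<open>A\<close>, or one that changes nothing, is still a legal step,
  so exactly \<open>card S\<close> steps are available for any finite \<open>S\<close>.\<close>

lemma updates_reach:
  assumes "finite S" "\<forall>c\<in>A - S. b c = b' c"
  shows "\<exists>b1. (op_step d ^^ card (S :: cell set)) (A, b) (A, b1) \<and> (\<forall>c\<in>A. b1 c = b' c)"
  using assms
proof (induction S arbitrary: b rule: finite_induct)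
  case empty
  then show ?case by auto
next
  case (insert x S)
  have "op_step d (A, b) (A, b(x := b' x))" by (auto simp: op_step_def)
  moreover have "\<forall>c\<in>A - S. (b(x := b' x)) c = b' c" using insert.prems by auto
  then obtain b1 where "(op_step d ^^ card S) (A, b(x := b' x)) (A, b1)" "\<forall>c\<in>A. b1 c = b' c"
    using insert.IH by blast
  ultimately show ?case using insert.hyps by (metis relpowp_Suc_I2 card_insert_disjoint)
qed

section \<open>Brand changes, total cost and the two kinds of operation\<close>

lemma brand_eqI:
  assumes "c \<in> ext d T m" "\<And>j. j \<le> m \<Longrightarrow> c \<in> ext d T j \<longleftrightarrow> c \<in> ext d T' j"
  shows "brand d T c = brand d T' c"
proof -
  have c': "c \<in> ext d T' m" using assms by blast
  \<comment> \<open>Both least indices are at most \<open>m\<close>, so stages beyond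
    \<open>m\<close> do not matter.\<close>
  have a: "c \<in> ext d T (brand d T c)" "brand d T c \<le> m"
    unfolding brand_def by (rule LeastI, rule assms(1), rule Least_le, rule assms(1))
  have b: "c \<in> ext d T' (brand d T' c)" "brand d T' c \<le> m"
    unfolding brand_def by (rule LeastI, rule c', rule Least_le, rule c')
  have "brand d T' c \<le> brand d T c"
    unfolding brand_def[of d T'] using a assms(2) by (intro Least_le) blast
  moreover have "brand d T c \<le> brand d T' c"
    unfolding brand_def[of d T c] using b assms(2) by (intro Least_le) blast
  ultimately show ?thesis by simp
qed

lemma split_opE:
  assumes "quadtree d T" "split_op d T T'"
  obtains I c where "node_closed d I" "c \<in> tree_of d I" "c \<notin> I"
    "T = tree_of d I" "T' = tree_of d (insert c I)"
proof -
  obtain I where I: "node_closed d I" "T = tree_of d I"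
    using assms(1) by (rule quadtree_obtain_nodes)
  obtain c where c: "leaf d T c" "T' = T \<union> children d c"
    using assms(2) by (auto simp: split_op_def)
  have cI: "c \<in> tree_of d I" "c \<notin> I" using c(1) I(2) by (auto simp: leaf_tree_of_iff)
  have "T' = tree_of d (insert c I)"
    using tree_of_insert[OF tree_of_valid[OF cI(1)] cI(1)] c(2) I(2) by simp
  then show thesis using that I cI by blast
qed

text \<open>Same shape as for a split with the two trees exchanged, so that one cost estimate serves
  both.\<close>

lemma merge_opE:
  assumes "quadtree d T" "merge_op d T T'"
  obtains I c where "node_closed d I" "c \<in> tree_of d I" "c \<notin> I"
    "T' = tree_of d I" "T = tree_of d (insert c I)"
proof -
  obtain K where K: "node_closed d K" "T = tree_of d K"
    using assms(1) by (rule quadtree_obtain_nodes)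
  obtain c where c: "c \<in> T" "children d c \<subseteq> T" "\<forall>x\<in>children d c. leaf d T x" "T' = T - children d c"
    using assms(2) by (auto simp: merge_op_def)
  have vc: "valid_cell d c" using c(1) K(2) tree_of_valid by blast
  obtain x where x: "x \<in> children d c" using children_ne[of d c] by blast
  have cK: "c \<in> K" using child_in_tree_of_iff[OF vc x, of K] c(2) x K(2) by blast
  \<comment> \<open>A node other than \<open>c\<close> with parent \<open>c\<close> would be a leaf
    by the merge condition. So removing \<open>c\<close> preserves closure under parents.\<close>
  have par: "parent p \<noteq> c" if p: "p \<in> K" "p \<noteq> c" for p
  proof
    assume e: "parent p = c"
    have vp: "valid_cell d p" using p K(1) by (auto simp: node_closed_def)
    have "fst p > 0"
      using valid_level_0[OF vp] e p(2) by (metis gr0I parent_root)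
    then have "p \<in> children d c" using e vp by (simp add: children_iff[OF vc])
    then have "leaf d T p" using c(3) by blast
    then show False using K(2) p(1) by (simp add: leaf_tree_of_iff)
  qed
  let ?I = "K - {c}"
  have I: "node_closed d ?I" using K(1) par by (auto simp: node_closed_def)
  have cT: "c \<in> tree_of d ?I"
  proof (cases "fst c = 0")
    case True
    then show ?thesis using valid_level_0[OF vc] by (simp add: tree_of_def)
  next
    case False
    then have "parent c \<noteq> c" by (metis fst_parent diff_less less_numeral_extra(1) neq0_conv less_irrefl)
    then show ?thesis using K(1) cK vc by (auto simp: tree_of_def node_closed_def)
  qed
  have T: "T = tree_of d (insert c ?I)" using K(2) cK by (simp add: insert_absorb)
  have "children d c \<inter> tree_of d ?I = {}"
    using child_in_tree_of_iff[OF vc, of _ ?I] by blast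
  then have "T' = tree_of d ?I"
    using c(4) T tree_of_insert[OF vc cT] by blast
  then show thesis using that[of ?I c] I cT T by blast
qed

text \<open>This is \<open>(1 + 1/d) ^ d <= e <= 3\<close>, cleared of denominators.\<close>

lemma Suc_power_self_le: "(d + 1) ^ d \<le> 3 * d ^ d" if "d \<ge> 1" for d :: nat
proof -
  have "(1 + 1 / real d) ^ d \<le> exp (1 / real d) ^ d"
    by (intro power_mono) auto
  also have "\<dots> = exp 1"
    using that by (simp add: exp_of_nat_mult[symmetric])
  also have "\<dots> \<le> 3" by (rule exp_le)
  finally have "(1 + 1 / real d) ^ d * real d ^ d \<le> 3 * real d ^ d"
    by (intro mult_right_mono) auto
  moreover have "(1 + 1 / real d) ^ d * real d ^ d = real ((d + 1) ^ d)"
    using that by (simp add: power_mult_distrib[symmetric] field_simps)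
  ultimately have "real ((d + 1) ^ d) \<le> real (3 * d ^ d)" by simp
  then show ?thesis by (simp only: of_nat_le_iff)
qed

text \<open>\<open>D\<close> holds the new internal nodes; \<open>S\<close> contains all old cells
  whose brand changes. The brand condition is an equation, so a merge can read the statement
  backwards.\<close>

lemma ext_tree_update_cost:
  assumes d: "d \<ge> 1" and I: "node_closed d I" and c: "c \<in> tree_of d I"
  defines "T \<equiv> tree_of d I" and "T' \<equiv> tree_of d (insert c I)"
  obtains D S where "finite D" "finite S" "card D + card S \<le> 3 * (2 * d) ^ d"
    "D \<inter> ext_nodes d d I = {}" "D \<subseteq> tree_of d (ext_nodes d d I)"
    "ext_tree d T = tree_of d (ext_nodes d d I)"
    "ext_tree d T' = tree_of d (ext_nodes d d I \<union> D)"
    "\<forall>x\<in>ext_tree d T - S. brand d T x = brand d T' x"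
proof
  have "parent c \<in> insert c I"
    using c by (auto simp: tree_of_def)
  then have I': "node_closed d (insert c I)"
    using I tree_of_valid[OF c] by (auto simp: node_closed_def)
  let ?E = "\<lambda>j. ext_nodes d j I" and ?E' = "\<lambda>j. ext_nodes d j (insert c I)"
  have EE: "?E j \<subseteq> ?E' j" for j by (rule ext_nodes_mono) auto
  note ext = ext_tree_of[OF I, folded T_def] ext_tree_of[OF I', folded T'_def]
  let ?G = "affected d c d"
  define D where "D = ?E' d - ?E d"
  \<comment> \<open>A brand changes only if the parent of the cell becomes a node at an earlier
    stage and hence is affected. Children of \<open>D\<close> are absent from the old tree and get
    their brand with the split.\<close>
  define S where "S = (\<Union>P\<in>?G - D. children d P)"
  have G: "finite ?G" "card ?G \<le> (d + 1) ^ d" using finite_affected_card_le by auto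
  have DG: "D \<subseteq> ?G" unfolding D_def by (rule ext_nodes_insert_diff_affected[OF I c])
  show "finite D" using DG G(1) by (rule finite_subset)
  show "finite S" unfolding S_def using G(1) finite_children_card_le by blast
  have "card S \<le> (\<Sum>P\<in>?G - D. card (children d P))"
    unfolding S_def using G(1) by (intro card_UN_le) auto
  also have "\<dots> \<le> (\<Sum>P\<in>?G - D. 2 ^ d)"
    using finite_children_card_le by (intro sum_mono) blast
  finally have "card S \<le> card (?G - D) * 2 ^ d" by simp
  \<comment> \<open>Counting a split as \<open>2 ^ d\<close> operations charges every affected node
    the same amount.\<close>
  moreover have "card D * 1 \<le> card D * 2 ^ d" by (intro mult_left_mono) auto
  ultimately have "card D + card S \<le> (card D + card (?G - D)) * 2 ^ d"
    unfolding add_mult_distrib by linarith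
  also have "card D + card (?G - D) = card ?G"
    using DG G(1) by (metis card_Diff_subset card_mono finite_subset le_add_diff_inverse)
  also have "card ?G * 2 ^ d \<le> 3 * d ^ d * 2 ^ d"
    using G(2) Suc_power_self_le[OF d] by (intro mult_right_mono) auto
  also have "\<dots> = 3 * (2 * d) ^ d" by (simp add: power_mult_distrib)
  finally show "card D + card S \<le> 3 * (2 * d) ^ d" .
  show "D \<inter> ?E d = {}" by (auto simp: D_def)
  show "D \<subseteq> tree_of d (?E d)"
    using ext_nodes_insert_subset_tree[OF I c] by (auto simp: D_def)
  show eT: "ext_tree d T = tree_of d (?E d)" using ext by (simp add: ext_tree_def)
  have "?E d \<union> D = ?E' d" using EE[of d] by (auto simp: D_def)
  then show "ext_tree d T' = tree_of d (?E d \<union> D)" using ext by (simp add: ext_tree_def)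
  show "\<forall>x\<in>ext_tree d T - S. brand d T x = brand d T' x"
  proof
    fix x assume x: "x \<in> ext_tree d T - S"
    \<comment> \<open>If \<open>x\<close> entered a stage earlier than before, its parent would be
      affected. The parent is not in \<open>D\<close>, as \<open>x\<close> is in the old extended
      tree, so \<open>x\<close> would be in \<open>S\<close>.\<close>
    have "x \<in> ext d T k \<longleftrightarrow> x \<in> ext d T' k" if k: "k \<le> Suc d" for k
    proof (cases k)
      case (Suc j)
      have "x \<in> tree_of d (?E j)" if x': "x \<in> tree_of d (?E' j)"
      proof (rule ccontr)
        assume n: "x \<notin> tree_of d (?E j)"
        have vx: "valid_cell d x" using x' by (rule tree_of_valid)
        have nr: "x \<noteq> root_cell d" "parent x \<notin> ?E j" using n vx by (auto simp: tree_of_def)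
        then have "fst x > 0" using valid_level_0[OF vx] by blast
        then have ch: "x \<in> children d (parent x)" using vx by (simp add: children_iff valid_parent)
        have "parent x \<in> ?E' j" using x' nr by (auto simp: tree_of_def)
        then have "parent x \<in> affected d c j"
          using ext_nodes_insert_diff_affected[OF I c, of j] nr by blast
        then have "parent x \<in> ?G" using affected_mono[of j d d c] k Suc by auto
        moreover have "parent x \<notin> D" using x nr eT by (auto simp: tree_of_def D_def)
        ultimately have "x \<in> S" using ch by (auto simp: S_def)
        then show False using x by simp
      qed
      then show ?thesis unfolding Suc ext using tree_of_mono[OF EE] by blast
    qed simp
    then show "brand d T x = brand d T' x"
      using x by (intro brand_eqI[of x d T "Suc d"]) (auto simp: ext_tree_def)
  qed
qed

theorem theorem22:
  "\<exists>C::nat. \<forall>d::nat. d \<ge> 1 \<longrightarrow> (\<forall>T T'. quadtree d T \<longrightarrow> (split_op d T T' \<or> merge_op d T T') \<longrightarrow>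
     (\<exists>n s'. n \<le> C * (2 * d) ^ d
        \<and> (op_step d ^^ n) (ext_tree d T, brand d T) s'
        \<and> fst s' = ext_tree d T'
        \<and> (\<forall>c\<in>fst s'. snd s' c = brand d T' c)))"
\<comment> \<open>The constant is the bound for e from \<open>Suc_power_self_le\<close>.\<close>
proof (rule exI[of _ 3], intro allI impI)
  fix d :: nat and T T'
  assume d: "d \<ge> 1" and q: "quadtree d T" and op: "split_op d T T' \<or> merge_op d T T'"
  let ?goal = "\<exists>n s'. n \<le> 3 * (2 * d) ^ d \<and> (op_step d ^^ n) (ext_tree d T, brand d T) s'
    \<and> fst s' = ext_tree d T' \<and> (\<forall>c\<in>fst s'. snd s' c = brand d T' c)"
  from op show ?goal
  proof
    assume "split_op d T T'"
    then obtain I c where I: "node_closed d I" "c \<in> tree_of d I"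
      and T: "T = tree_of d I" "T' = tree_of d (insert c I)"
      using split_opE[OF q] by metis
    obtain D S where fin: "finite D" "finite S" and cost: "card D + card S \<le> 3 * (2 * d) ^ d"
      and D: "D \<inter> ext_nodes d d I = {}" "D \<subseteq> tree_of d (ext_nodes d d I)"
      and e: "ext_tree d T = tree_of d (ext_nodes d d I)"
        "ext_tree d T' = tree_of d (ext_nodes d d I \<union> D)"
      and b: "\<forall>x\<in>ext_tree d T - S. brand d T x = brand d T' x"
      using ext_tree_update_cost[OF d I] unfolding T by metis
    \<comment> \<open>Updating first makes the brands final on the old tree, as
      \<open>splits_reach\<close> requires.\<close>
    obtain b1 where b1: "(op_step d ^^ card S) (ext_tree d T, brand d T) (ext_tree d T, b1)"
      "\<forall>x\<in>ext_tree d T. b1 x = brand d T' x"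
      using updates_reach[OF fin(2) b] by blast
    obtain b2 where b2: "(op_step d ^^ card D) (ext_tree d T, b1) (ext_tree d T', b2)"
      "\<forall>x\<in>ext_tree d T'. b2 x = brand d T' x"
      using splits_reach[OF fin(1) D b1(2)[unfolded e]] unfolding e by blast
    have "(op_step d ^^ (card S + card D)) (ext_tree d T, brand d T) (ext_tree d T', b2)"
      using b1(1) b2(1) by (auto simp: relpowp_add)
    then show ?goal using cost b2(2)
      by (intro exI[of _ "card S + card D"] exI[of _ "(ext_tree d T', b2)"]) auto
  next
    assume "merge_op d T T'"
    then obtain I c where I: "node_closed d I" "c \<in> tree_of d I"
      and T: "T' = tree_of d I" "T = tree_of d (insert c I)"
      using merge_opE[OF q] by metis
    obtain D S where fin: "finite D" "finite S" and cost: "card D + card S \<le> 3 * (2 * d) ^ d"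
      and D: "D \<inter> ext_nodes d d I = {}" "D \<subseteq> tree_of d (ext_nodes d d I)"
      and e: "ext_tree d T' = tree_of d (ext_nodes d d I)"
        "ext_tree d T = tree_of d (ext_nodes d d I \<union> D)"
      and b: "\<forall>x\<in>ext_tree d T' - S. brand d T' x = brand d T x"
      using ext_tree_update_cost[OF d I] unfolding T by metis
    \<comment> \<open>Merging first leaves only the cells of the smaller tree to be
      rebranded.\<close>
    have m: "(op_step d ^^ card D) (ext_tree d T, brand d T) (ext_tree d T', brand d T)"
      unfolding e by (rule merges_reach[OF fin(1) D node_closed_ext_nodes[OF I(1)]])
    have "\<forall>x\<in>ext_tree d T' - S. brand d T x = brand d T' x" using b by simp
    then obtain b1 where b1: "(op_step d ^^ card S) (ext_tree d T', brand d T) (ext_tree d T', b1)"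
      "\<forall>x\<in>ext_tree d T'. b1 x = brand d T' x"
      using updates_reach[OF fin(2)] by blast
    have "(op_step d ^^ (card D + card S)) (ext_tree d T, brand d T) (ext_tree d T', b1)"
      using m b1(1) by (auto simp: relpowp_add)
    then show ?goal using cost b1(2)
      by (intro exI[of _ "card D + card S"] exI[of _ "(ext_tree d T', b1)"]) auto
  qed
qed

end
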